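(* $${}_2F_1\left(\tfrac7{10},\tfrac9{10};\tfrac{11}{10};\tfrac3{128}\right)=\frac{8}{75}\,\frac{\sqrt2\,\Gamma(1/5)^3\,\Gamma(2/5)}{(\sqrt5+1)\,\pi^2}.$$
   Context: For complex $a,b,c$ with $c\notin\{0,-1,-2,\dots\}$ and $|x|<1$, ${}_2F_1(a,b;c;x)=\sum_{n\ge 0}\frac{(a,n)(b,n)}{(c,n)(1,n)}x^n$ denotes Gauss's hypergeometric series, where $(\alpha,n)=\alpha(\alpha+1)\cdots(\alpha+n-1)$, $(\alpha,0)=1$. *)

theory Defs
  imports "HOL-Analysis.Analysis"
begin

(* Meaningful only for c not in {0, -1, -2, ...} and norm x < 1, where the series
   is well defined and converges; outside this range the value is not intended. *)
definition hyp2F1 :: "complex \<Rightarrow> complex \<Rightarrow> complex \<Rightarrow> complex \<Rightarrow> complex" where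
  "hyp2F1 a b c x =
     (\<Sum>n. pochhammer a n * pochhammer b n / (pochhammer c n * pochhammer 1 n) * x ^ n)"

end

(* By Euler's integral, F(7/10,9/10;11/10;x) B(9/10,1/5) is the integral over [0,1] of
   t^(-1/10) (1-t)^(-4/5) (1-xt)^(-7/10).  A Schwarz-Christoffel map with this integrand sends the
   half-plane to a quadrilateral with angles 9pi/10, pi/5, 3pi/10, 6pi/10; for x = 3/128 it is tiled
   by triangles with angles pi/5, pi/2, 3pi/10.  The tiling gives a degree 6 Belyi map
   s = t^3 (1 - 3t/128) / (K D(t)^2) with 1 - s = (1-t) (1-t/16)^5 / D(t)^2, where D is a cubic and
   K = 2^15/5^5, and s pulls s^(-7/10) (1-s)^(-4/5) ds back to a multiple of the integrand above.
   So the integral is a multiple of B(3/10,1/5), and the rest is duplication and reflection. *)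
theory Submission
  imports Defs
begin

section \<open>Beta integrals and Euler's integral for the Gauss series\<close>

lemma nn_integral_Beta_real:
  fixes a b :: real
  assumes "a > 0" "b > 0"
  shows "(\<integral>\<^sup>+ t. ennreal (t powr (a - 1) * (1 - t) powr (b - 1)) * indicator {0..1} t \<partial>lborel)
    = ennreal (Beta a b)"
  using nn_integral_has_integral_lebesgue[OF _ has_integral_Beta_real[OF assms]]
  by (simp add: indicator_mult_ennreal mult.commute)

lemma Beta_pochhammer:
  fixes b d :: real
  assumes "b > 0" "d > 0"
  shows "Beta (b + real n) d = Beta b d * pochhammer b n / pochhammer (b + d) n"
proof -
  have "b \<notin> \<int>\<^sub>\<le>\<^sub>0" "b + d \<notin> \<int>\<^sub>\<le>\<^sub>0"
    using assms by (auto elim!: nonpos_Ints_cases)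
  moreover have "Gamma b > 0" "Gamma (b + d) > 0"
    using assms by simp_all
  ultimately show ?thesis
    by (simp add: Beta_def pochhammer_Gamma field_simps)
qed

lemma negative_binomial_sums:
  fixes a z :: real
  assumes "\<bar>z\<bar> < 1"
  shows "(\<lambda>n. pochhammer a n / fact n * z ^ n) sums (1 - z) powr (- a)"
proof -
  have "(\<lambda>n. (- a gchoose n) * (- z) ^ n) sums (1 + - z) powr (- a)"
    using assms by (intro gen_binomial_real) auto
  moreover have "(- a gchoose n) * (- z) ^ n = pochhammer a n / fact n * z ^ n" for n
  proof -
    have "(- 1) ^ n * (- z) ^ n = z ^ n"
      by (simp flip: power_mult_distrib)
    then show ?thesis
      by (simp add: gbinomial_pochhammer mult_ac)
  qed
  ultimately show ?thesis by simp
qed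

text \<open>Expand (1 - x t)^(-a) by the binomial series and integrate term by term; the n-th term
  is a Beta integral with first parameter b + n. With a and x nonnegative every term is nonnegative,
  so the interchange is monotone convergence and needs no bounds. Working in the extended reals, the
  finite value \<open>I\<close> then also yields convergence of the series.\<close>

lemma Gauss_series_sums_Euler_integral:
  fixes a b c x I :: real
  assumes "0 \<le> a" "0 < b" "b < c" "0 \<le> x" "x < 1" "0 \<le> I"
    and I: "(\<integral>\<^sup>+ t. ennreal (t powr (b - 1) * (1 - t) powr (c - b - 1) * (1 - x * t) powr (- a))
              * indicator {0..1} t \<partial>lborel) = ennreal I"
  shows "(\<lambda>n. pochhammer a n * pochhammer b n / (pochhammer c n * pochhammer 1 n) * x ^ n)
    sums (I / Beta b (c - b))"
proof -
  define B where "B = Beta b (c - b)"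
  define w where "w t = t powr (b - 1) * (1 - t) powr (c - b - 1)" for t
  define k where "k n = pochhammer a n / fact n * x ^ n" for n
  define u where "u n = pochhammer a n * pochhammer b n / (pochhammer c n * pochhammer 1 n) * x ^ n"
    for n
  have B: "B > 0"
    using assms by (simp add: B_def Beta_def)
  have poch: "pochhammer y n \<ge> 0" if "y \<ge> 0" for y :: real and n
    using that by (simp add: pochhammer_prod prod_nonneg)
  have k: "k n \<ge> 0" and u: "u n \<ge> 0" for n
    using assms by (simp_all add: k_def u_def poch)
  have expand: "ennreal (w t * (1 - x * t) powr (- a)) * indicator {0..1} t
      = (\<Sum>n. ennreal (k n) * (ennreal (t powr (b + real n - 1) * (1 - t) powr (c - b - 1))
          * indicator {0..1} t))" for t
  proof (cases "t \<in> {0..1}")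
    case True
    then have "x * t \<le> x * 1" "0 \<le> x * t"
      using assms by (auto intro!: mult_left_mono simp del: mult_1_right)
    then have "\<bar>x * t\<bar> < 1" using assms by simp
    from sums_mult[OF negative_binomial_sums[OF this, of a], of "w t"]
    have "(\<lambda>n. w t * (k n * t ^ n)) sums (w t * (1 - x * t) powr (- a))"
      by (simp add: k_def power_mult_distrib mult_ac)
    moreover have "w t * (k n * t ^ n) = k n * (t powr (b + real n - 1) * (1 - t) powr (c - b - 1))" for n
    proof -
      have "t powr (b + real n - 1) = t powr (b - 1) * t powr real n"
        by (simp flip: powr_add add: algebra_simps)
      \<comment> \<open>The case t = 0 is separate because \<open>0 powr 0 = 0\<close> while
        \<open>0 ^ 0 = 1\<close>; there both sides vanish through the factors
        \<open>0 powr _\<close>.\<close>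
      then show ?thesis
        using True by (cases "t = 0") (simp_all add: w_def powr_realpow)
    qed
    ultimately have "(\<lambda>n. k n * (t powr (b + real n - 1) * (1 - t) powr (c - b - 1)))
        sums (w t * (1 - x * t) powr (- a))"
      by simp
    then have "ennreal (w t * (1 - x * t) powr (- a))
        = (\<Sum>n. ennreal (k n * (t powr (b + real n - 1) * (1 - t) powr (c - b - 1))))"
      using k by (subst suminf_ennreal2) (auto simp: sums_iff)
    then show ?thesis
      using True k by (simp add: ennreal_mult)
  qed simp
  have "ennreal I = (\<integral>\<^sup>+ t. (\<Sum>n. ennreal (k n) *
      (ennreal (t powr (b + real n - 1) * (1 - t) powr (c - b - 1)) * indicator {0..1} t)) \<partial>lborel)"
    unfolding I[symmetric] w_def[symmetric] expand ..
  also have "\<dots> = (\<Sum>n. ennreal (k n) * (\<integral>\<^sup>+ t.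
      ennreal (t powr (b + real n - 1) * (1 - t) powr (c - b - 1)) * indicator {0..1} t \<partial>lborel))"
    by (subst nn_integral_suminf) (simp_all add: nn_integral_cmult)
  also have "\<dots> = (\<Sum>n. ennreal (B * u n))"
  proof (intro suminf_cong)
    fix n
    have "Beta (b + real n) (c - b) = B * pochhammer b n / pochhammer c n"
      using Beta_pochhammer[of b "c - b" n] assms by (simp add: B_def)
    then have "k n * Beta (b + real n) (c - b) = B * u n"
      by (simp add: k_def u_def pochhammer_fact mult_ac)
    moreover have "(\<integral>\<^sup>+ t. ennreal (t powr (b + real n - 1) * (1 - t) powr (c - b - 1))
        * indicator {0..1} t \<partial>lborel) = ennreal (Beta (b + real n) (c - b))"
      using assms by (intro nn_integral_Beta_real) auto
    ultimately show "ennreal (k n) * (\<integral>\<^sup>+ t. ennreal (t powr (b + real n - 1) *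
        (1 - t) powr (c - b - 1)) * indicator {0..1} t \<partial>lborel) = ennreal (B * u n)"
      using k[of n] by (simp flip: ennreal_mult')
  qed
  finally have I': "ennreal I = (\<Sum>n. ennreal (B * u n))" .
  have nn: "0 \<le> B * u n" for n using B u by simp
  \<comment> \<open>Summability comes from the finiteness of the integral: a nonnegative series
    whose extended sum is not infinite converges.\<close>
  have summable: "summable (\<lambda>n. B * u n)"
    using I' nn by (intro summable_suminf_not_top) (auto simp flip: I')
  then have "ennreal I = ennreal (\<Sum>n. B * u n)"
    using I' nn by (simp add: suminf_ennreal2)
  then have "I = (\<Sum>n. B * u n)"
    using suminf_nonneg[OF summable nn] assms(6) by (subst (asm) ennreal_inj)
  then have "(\<lambda>n. B * u n) sums I"
    using summable by (simp add: sums_iff)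
  from sums_divide[OF this, of B] show ?thesis
    unfolding u_def[symmetric] B_def[symmetric] using B by simp
qed

section \<open>Special values of the sine\<close>

lemma sin_pi_tenth: "sin (pi / 10) = (sqrt 5 - 1) / 4"
proof -
  define s c where "s = sin (pi / 10)" and "c = cos (pi / 10)"
  have s: "s > 0" unfolding s_def by (intro sin_gt_zero) auto
  have c: "c > 0" unfolding c_def by (intro cos_gt_zero) auto
  \<comment> \<open>Five times pi/10 is pi/2, so the cosine of the triple angle equals the sine of
    the double angle. Dividing by c leaves 4 s^2 + 2 s - 1 = 0, and s > 0 selects the root.\<close>
  have "cos (3 * (pi / 10)) = sin (pi / 2 - 3 * (pi / 10))"
    by (subst cos_sin_eq) simp
  also have "pi / 2 - 3 * (pi / 10) = 2 * (pi / 10)" by simp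
  finally have "4 * c ^ 3 - 3 * c = 2 * s * c"
    unfolding cos_treble_cos sin_double by (simp add: s_def c_def)
  then have "c * (4 * c\<^sup>2 - 3) = c * (2 * s)"
    by (simp add: power2_eq_square power3_eq_cube algebra_simps)
  then have "4 * c\<^sup>2 - 3 = 2 * s" using c by simp
  moreover have "s\<^sup>2 + c\<^sup>2 = 1" by (simp add: s_def c_def)
  ultimately have "(4 * s + 1)\<^sup>2 = 5"
    by (simp add: power2_eq_square algebra_simps)
  then have "4 * s + 1 = sqrt 5"
    using s by (intro real_sqrt_unique[symmetric]) auto
  then show ?thesis by (simp add: s_def)
qed

lemma sin_pi_fifth_mult: "sin (pi / 5) * sin (2 * pi / 5) = sqrt 5 / 4"
proof -
  have "sin (pi / 5) * sin (2 * pi / 5) = (cos (pi / 5) - cos (3 * pi / 5)) / 2"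
    by (simp add: sin_times_sin flip: cos_minus[of "pi / 5 - 2 * pi / 5"])
  also have "cos (3 * pi / 5) = - sin (pi / 10)"
    using cos_add[of "pi / 2" "pi / 10"] by simp
  also have "cos (pi / 5) = 1 - 2 * (sin (pi / 10))\<^sup>2"
    using cos_double_sin[of "pi / 10"] by simp
  also have "(sin (pi / 10))\<^sup>2 = (3 - sqrt 5) / 8"
    by (simp add: sin_pi_tenth power2_eq_square field_simps)
  also have "(1 - 2 * ((3 - sqrt 5) / 8) - - sin (pi / 10)) / 2 = sqrt 5 / 4"
    unfolding sin_pi_tenth by (simp add: field_simps)
  finally show ?thesis .
qed


section \<open>Gamma identities and the ratio of two Beta values\<close>

lemma Gamma_legendre_duplication_real:
  fixes z :: real
  assumes "z > 0"
  shows "Gamma z * Gamma (z + 1/2) = 2 powr (1 - 2 * z) * sqrt pi * Gamma (2 * z)"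
proof -
  have *: "complex_of_real y \<notin> \<int>\<^sub>\<le>\<^sub>0" if "y > 0" for y
    using that nonpos_Ints_nonpos[of y] by (auto simp: of_real_in_nonpos_Ints_iff)
  have "complex_of_real z + 1/2 \<notin> \<int>\<^sub>\<le>\<^sub>0"
    using *[of "z + 1/2"] assms by simp
  from Gamma_legendre_duplication[OF *[OF assms] this]
  have "complex_of_real (Gamma z * Gamma (z + 1/2))
      = of_real (exp ((1 - 2 * z) * ln 2) * sqrt pi * Gamma (2 * z))"
    by (simp flip: Gamma_complex_of_real exp_of_real)
  then show ?thesis
    unfolding of_real_eq_iff by (simp add: powr_def)
qed

text \<open>Integers z are covered too: one of the two Gamma factors is then at a pole, where
  \<open>Gamma\<close> takes the value 0, and the right side is a division by zero, hence also
  0.\<close>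

lemma Gamma_reflection_real:
  fixes z :: real
  shows "Gamma z * Gamma (1 - z) = pi / sin (pi * z)"
proof -
  have "complex_of_real (Gamma z * Gamma (1 - z)) = of_real (pi / sin (pi * z))"
    using Gamma_reflection_complex[of "of_real z"]
    by (simp flip: Gamma_complex_of_real sin_of_real)
  then show ?thesis
    unfolding of_real_eq_iff .
qed

text \<open>The ratio reduces to G3 G1 / (10 sqrt(pi) G9). Reflection at 1/10 replaces
  \<open>G9\<close> by \<open>G1\<close>, duplication at 1/10 and 3/10 trades the odd tenths for
  fifths, and reflection at 1/5 and 2/5 removes \<open>g3\<close> and \<open>g4\<close>.\<close>

lemma Beta_ratio_eq_Gamma_fifths:
  "Beta (3/10) (1/5) / Beta (9/10) (1/5 :: real)
    = sqrt 5 * Gamma (1/5) ^ 3 * Gamma (2/5) / (10 * pi\<^sup>2) * sin (pi / 10)"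
proof -
  define G1 G3 G9 g1 g2 g3 g4 :: real where G_defs: "G1 = Gamma (1/10)" "G3 = Gamma (3/10)"
    "G9 = Gamma (9/10)" "g1 = Gamma (1/5)" "g2 = Gamma (2/5)" "g3 = Gamma (3/5)" "g4 = Gamma (4/5)"
  have pos: "G1 > 0" "G3 > 0" "G9 > 0" "g1 > 0" "g2 > 0" "g3 > 0" "g4 > 0"
    by (simp_all add: G_defs)
  have s: "sin (pi / 10) > 0" "sin (pi / 5) > 0" "sin (2 * pi / 5) > 0"
    by (auto intro!: sin_gt_zero)
  have dup1: "G1 * g3 = 2 powr (4/5) * sqrt pi * g1"
    using Gamma_legendre_duplication_real[of "1/10"] by (simp add: G_defs)
  have dup3: "G3 * g4 = 2 powr (2/5) * sqrt pi * g3"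
    using Gamma_legendre_duplication_real[of "3/10"] by (simp add: G_defs)
  have "G1 * G9 = pi / sin (pi / 10)"
    using Gamma_reflection_real[of "1/10"] by (simp add: G_defs)
  then have G9: "G9 = pi / (sin (pi / 10) * G1)"
    using pos s by (simp add: field_simps)
  have refl1: "g1 * g4 * sin (pi / 5) = pi"
    using Gamma_reflection_real[of "1/5"] s by (simp add: G_defs field_simps)
  have refl2: "g2 * g3 * sin (2 * pi / 5) = pi"
    using Gamma_reflection_real[of "2/5"] s by (simp add: G_defs field_simps)
  have powr2: "2 powr (2/5) * (2 powr (4/5))\<^sup>2 = (4::real)"
  proof -
    have "2 powr (2/5) * (2 powr (4/5))\<^sup>2 = 2 powr (2/5 + 4/5 + 4/5 :: real)"
      unfolding powr_add by (simp add: power2_eq_square)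
    then show ?thesis by simp
  qed
  \<comment> \<open>The grouping fits the two duplication formulas; the surplus \<open>g3\<close> in
    the square cancels against the one on the right of \<open>dup3\<close>.\<close>
  have "G3 * G1\<^sup>2 * (g3 * g4) = (G3 * g4) * (G1 * g3)\<^sup>2 / g3"
    using pos by (simp add: field_simps power2_eq_square)
  also have "\<dots> = 2 powr (2/5) * (2 powr (4/5))\<^sup>2 * ((sqrt pi)\<^sup>2 * sqrt pi * g1\<^sup>2)"
    unfolding dup1 dup3 using pos by (simp add: field_simps power2_eq_square)
  also have "\<dots> = 4 * pi * sqrt pi * g1\<^sup>2"
    unfolding powr2 by simp
  finally have A: "G3 * G1\<^sup>2 * (g3 * g4) = 4 * pi * sqrt pi * g1\<^sup>2" .
  have "g3 * g4 * (g1 * g2) * (sin (pi / 5) * sin (2 * pi / 5))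
      = (g1 * g4 * sin (pi / 5)) * (g2 * g3 * sin (2 * pi / 5))"
    by (simp add: mult_ac)
  also have "\<dots> = pi\<^sup>2"
    unfolding refl1 refl2 by (simp add: power2_eq_square)
  finally have B: "g3 * g4 * (g1 * g2) * (sqrt 5 / 4) = pi\<^sup>2"
    unfolding sin_pi_fifth_mult .
  have "pi\<^sup>2 * (G3 * G1\<^sup>2) = (G3 * G1\<^sup>2 * (g3 * g4)) * (g1 * g2) * (sqrt 5 / 4)"
    unfolding B[symmetric] by simp
  also have "\<dots> = pi * (sqrt pi * sqrt 5 * g1 ^ 3 * g2)"
    unfolding A by (simp add: power2_eq_square power3_eq_cube)
  finally have C: "pi * (G3 * G1\<^sup>2) = sqrt pi * sqrt 5 * g1 ^ 3 * g2"
    by (simp add: power2_eq_square)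
  have "Gamma (9/10 + 1/5) = G1 / 10"
    using Gamma_plus1[of "1/10 :: real"] by (force simp: G_defs elim!: nonpos_Ints_cases)
  moreover have "Gamma (3/10 + 1/5) = sqrt pi"
    by (simp add: Gamma_one_half_real)
  ultimately have "Beta (3/10) (1/5) = G3 * g1 / sqrt pi" "Beta (9/10) (1/5) = G9 * g1 / (G1 / 10)"
    by (simp_all only: Beta_def G_defs)
  then have "Beta (3/10) (1/5) / Beta (9/10) (1/5 :: real) = G3 * G1 / (10 * sqrt pi * G9)"
    using pos by simp
  also have "\<dots> = (pi * (G3 * G1\<^sup>2)) * sin (pi / 10) / (10 * sqrt pi * pi\<^sup>2)"
    unfolding G9 using pos s by (simp add: field_simps power2_eq_square)
  also have "\<dots> = sqrt 5 * g1 ^ 3 * g2 / (10 * pi\<^sup>2) * sin (pi / 10)"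
    unfolding C by simp
  finally show ?thesis by (simp add: G_defs)
qed

section \<open>Change of variables along the Belyi map\<close>

lemma powr_monomial_cancel:
  fixes t q K d m p :: real
  assumes "t > 0" "q > 0" "K > 0" "d > 0" "m > 0" "p > 0"
  shows "(t ^ 3 * q / (K * d\<^sup>2)) powr (- 7/10) * (m * p ^ 5 / d\<^sup>2) powr (- 4/5)
      * (3 / K * t\<^sup>2 * p ^ 4 / d ^ 3)
    = 3 * K powr (- 3/10) * (t powr (- 1/10) * m powr (- 4/5) * q powr (- 7/10))"
    (is "?L = ?R")
proof -
  \<comment> \<open>Logarithms turn the claim into a comparison of exponents. For t it is 3(-7/10) +
    2 = -1/10; for p, 5(-4/5) + 4 = 0; for d, 7/5 + 8/5 - 3 = 0; for K, 7/10 - 1 = -3/10. So p and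
    d, the factors foreign to Euler's integrand, drop out.\<close>
  have "ln ?L = ln ?R"
    using assms by (simp add: ln_mult ln_div ln_realpow algebra_simps add_divide_distrib)
  moreover have "?L > 0" "?R > 0" using assms by simp_all
  ultimately show ?thesis by (simp only: ln_inj_iff)
qed

lemma nn_integral_eq_Beta:
  "(\<integral>\<^sup>+ t. ennreal (t powr (- 1/10) * (1 - t) powr (- 4/5) * (1 - 3/128 * t) powr (- 7/10))
      * indicator {0..1} t \<partial>lborel)
    = ennreal (16 * sqrt 2 / (15 * sqrt 5) * Beta (3/10) (1/5))"
proof -
  define K :: real where "K = 32768/3125"
  \<comment> \<open>The identity K D^2 = K (1-t) (1-t/16)^5 + t^3 (1 - 3t/128) forces
    \<open>D\<close>, normalised by D(0) = 1, to agree with the square root of (1-t) (1-t/16)^5 up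
    to t^2; comparing t^6 gives the last coefficient up to sign.\<close>
  define D where "D t = 1 - 21/32 * t - 81/2048 * t\<^sup>2 + 1/1024 * t ^ 3" for t :: real
  define g where "g t = t ^ 3 * (1 - 3/128 * t) / (K * (D t)\<^sup>2)" for t
  define g' where "g' t = 3 / K * t\<^sup>2 * (1 - t/16) ^ 4 / (D t) ^ 3" for t
  define f where "f s = s powr (- 7/10) * (1 - s) powr (- 4/5)" for s :: real
  define h where "h t = t powr (- 1/10) * (1 - t) powr (- 4/5) * (1 - 3/128 * t) powr (- 7/10)"
    for t :: real
  define C where "C = 16 * sqrt 2 / (15 * sqrt 5)"
  have K: "K > 0" by (simp add: K_def)
  have C: "C > 0" by (simp add: C_def)
  have D: "D t > 0" if "t \<in> {0..1}" for t
  proof -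
    have "t\<^sup>2 \<le> 1" "0 \<le> t ^ 3" using that by (auto intro: power_le_one)
    then show ?thesis using that unfolding D_def atLeastAtMost_iff by linarith
  qed
  have g01: "g 0 = 0" "g 1 = 1"
    by (simp_all add: g_def D_def K_def power2_eq_square)
  have one_minus_g: "1 - g t = (1 - t) * (1 - t/16) ^ 5 / (D t)\<^sup>2" if "t \<in> {0..1}" for t
  proof -
    have "1 - g t = (K * (D t)\<^sup>2 - t ^ 3 * (1 - 3/128 * t)) / (K * (D t)\<^sup>2)"
      using D[OF that] K by (simp add: g_def diff_divide_distrib)
    also have "K * (D t)\<^sup>2 - t ^ 3 * (1 - 3/128 * t) = K * ((1 - t) * (1 - t/16) ^ 5)"
      unfolding D_def K_def by algebra
    finally show ?thesis
      using K by simp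
  qed
  have deriv: "(g has_real_derivative g' t) (at t)" if "t \<in> {0..1}" for t
  proof -
    define D' where "D' = - 21/32 - 81/1024 * t + 3/1024 * t\<^sup>2"
    define n where "n = t ^ 3 * (1 - 3/128 * t)"
    define n' where "n' = 3 * t\<^sup>2 - 3/32 * t ^ 3"
    have d: "(D has_real_derivative D') (at t)"
      unfolding D_def D'_def by (auto intro!: derivative_eq_intros)
    have n: "((\<lambda>t. t ^ 3 * (1 - 3/128 * t)) has_real_derivative n') (at t)"
      unfolding n'_def
      by (auto intro!: derivative_eq_intros simp: algebra_simps power2_eq_square power3_eq_cube)
    \<comment> \<open>The triple zero of g at 0 and the fivefold zero of 1 - g at 16 force the
      factors t^2 and (1 - t/16)^4. The left side has degree 6, so only a constant remains, and the
      t^2 term shows that it is 3.\<close>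
    have "n' * D t - 2 * n * D' = 3 * t\<^sup>2 * (1 - t/16) ^ 4"
      unfolding n_def n'_def D_def D'_def by algebra
    moreover have "(g has_real_derivative
        (n' * (K * (D t)\<^sup>2) - n * (K * (2 * D t * D'))) / (K * (D t)\<^sup>2 * (K * (D t)\<^sup>2))) (at t)"
      unfolding g_def n_def
      by (rule DERIV_divide[OF n]) (use D[OF that] K in \<open>auto intro!: derivative_eq_intros d\<close>)
    moreover have "(n' * (K * (D t)\<^sup>2) - n * (K * (2 * D t * D'))) / (K * (D t)\<^sup>2 * (K * (D t)\<^sup>2))
        = (n' * D t - 2 * n * D') / (K * (D t) ^ 3)"
    proof -
      have eqs: "n' * (K * (D t)\<^sup>2) - n * (K * (2 * D t * D')) = (K * D t) * (n' * D t - 2 * n * D')"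
        "K * (D t)\<^sup>2 * (K * (D t)\<^sup>2) = (K * D t) * (K * (D t) ^ 3)"
        by (simp_all add: power2_eq_square power3_eq_cube algebra_simps)
      show ?thesis
        unfolding eqs using D[OF that] K by simp
    qed
    ultimately show ?thesis
      by (simp add: g'_def)
  qed
  have contD: "continuous_on {0..1} D"
    unfolding D_def by (intro continuous_intros)
  have cont: "continuous_on {0..1} g'"
    unfolding g'_def by (intro continuous_intros contD) (use less_imp_neq[OF D] K in auto)
  have g'_nonneg: "g' t \<ge> 0" if "t \<in> {0..1}" for t
    using D[OF that] K by (simp add: g'_def)
  have C_powr: "C = K powr (3/10) / 3"
  proof -
    have "ln (K powr (3/10)) = ln (16 * sqrt 2 / (5 * sqrt 5))"
    proof -
      have "ln K = 15 * ln 2 - 5 * ln 5"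
        using ln_realpow[of 2 15] ln_realpow[of 5 5] by (simp add: K_def ln_div)
      moreover have "ln (16 * sqrt 2 / (5 * sqrt 5)) = 4 * ln 2 + ln 2 / 2 - (ln 5 + ln 5 / 2)"
        using ln_realpow[of 2 4] by (simp add: ln_div ln_mult ln_sqrt)
      ultimately show ?thesis using K by (simp add: ln_powr)
    qed
    then have "K powr (3/10) = 16 * sqrt 2 / (5 * sqrt 5)"
      using K by (subst (asm) ln_inj_iff) auto
    then show ?thesis by (simp add: C_def)
  qed
  have pullback: "h t = C * (f (g t) * g' t)" if "t \<in> {0..1}" for t
  proof (cases "t = 0 \<or> t = 1")
    \<comment> \<open>At the endpoints both sides are 0, since 0 raised by \<open>powr\<close> to a
      negative exponent is 0.\<close>
    case True
    then show ?thesis using g01 by (auto simp: h_def f_def)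
  next
    case False
    then have t: "0 < t" "t < 1" using that by auto
    have "f (g t) * g' t = 3 * K powr (- 3/10) * h t"
      unfolding f_def one_minus_g[OF that] unfolding h_def g_def g'_def
      by (rule powr_monomial_cancel) (use t D[OF that] K in auto)
    moreover have "K powr (3/10) * K powr (- 3/10) = 1"
      using K by (simp flip: powr_add)
    ultimately show ?thesis by (simp add: C_powr)
  qed
  have [measurable]: "f \<in> borel_measurable borel" "g \<in> borel_measurable borel"
      "g' \<in> borel_measurable borel"
    unfolding f_def g_def g'_def D_def by measurable
  have "ennreal (Beta (3/10) (1/5)) = (\<integral>\<^sup>+ s. f s * indicator {g 0..g 1} s \<partial>lborel)"
    using nn_integral_Beta_real[of "3/10" "1/5"]
    by (simp add: g01 f_def indicator_mult_ennreal mult.commute)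
  \<comment> \<open>The singularities of \<open>f\<close> at 0 and 1 do no harm: for nonnegative
    integrals the substitution rule asks only that \<open>f\<close> be measurable, with
    \<open>g'\<close> continuous and nonnegative.\<close>
  also have "\<dots> = (\<integral>\<^sup>+ t. f (g t) * g' t * indicator {0..1} t \<partial>lborel)"
    by (rule nn_integral_substitution[OF _ deriv cont g'_nonneg])
      (auto simp: set_borel_measurable_def)
  finally have "ennreal (C * Beta (3/10) (1/5))
      = ennreal C * (\<integral>\<^sup>+ t. f (g t) * g' t * indicator {0..1} t \<partial>lborel)"
    using C by (simp add: ennreal_mult')
  also have "\<dots> = (\<integral>\<^sup>+ t. ennreal C * ennreal (f (g t) * g' t * indicator {0..1} t) \<partial>lborel)"
    by (rule nn_integral_cmult[symmetric]) measurable
  also have "\<dots> = (\<integral>\<^sup>+ t. ennreal (h t) * indicator {0..1} t \<partial>lborel)"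
    using C by (intro nn_integral_cong) (auto simp: pullback ennreal_mult' split: split_indicator)
  finally show ?thesis by (simp add: h_def C_def)
qed

section \<open>Evaluation of the series\<close>

theorem mainTheorem18:
  shows "hyp2F1 (7/10) (9/10) (11/10) (3/128) =
    complex_of_real
      ((8/75) * ((sqrt 2 * Gamma (1/5) ^ 3 * Gamma (2/5)) / ((sqrt 5 + 1) * pi\<^sup>2)))"
proof -
  have "Beta (3/10) (1/5) \<ge> (0::real)"
    by (simp add: Beta_def)
  then have real_sums: "(\<lambda>n. pochhammer (7/10) n * pochhammer (9/10) n
      / (pochhammer (11/10) n * pochhammer 1 n) * (3/128) ^ n)
    sums (16 * sqrt 2 / (15 * sqrt 5) * Beta (3/10) (1/5) / Beta (9/10) (11/10 - 9/10 :: real))"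
    using nn_integral_eq_Beta by (intro Gauss_series_sums_Euler_integral) simp_all
  have "16 * sqrt 2 / (15 * sqrt 5) * Beta (3/10) (1/5) / Beta (9/10) (11/10 - 9/10 :: real)
      = 16 * sqrt 2 / (15 * sqrt 5) * (Beta (3/10) (1/5) / Beta (9/10) (1/5 :: real))"
    by simp
  also have "\<dots> = (8/75) * (sqrt 2 * Gamma (1/5) ^ 3 * Gamma (2/5) / pi\<^sup>2) * sin (pi / 10)"
    unfolding Beta_ratio_eq_Gamma_fifths by simp
  also have "sin (pi / 10) = 1 / (sqrt 5 + 1)"
  proof -
    have "(sqrt 5 - 1) * (sqrt 5 + 1) = 4"
      by (simp add: algebra_simps)
    moreover have "sqrt 5 + 1 > 0"
      by (simp add: add_pos_pos)
    ultimately show ?thesis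
      unfolding sin_pi_tenth by (simp add: field_simps)
  qed
  finally have "(\<lambda>n. pochhammer (7/10) n * pochhammer (9/10) n
      / (pochhammer (11/10) n * pochhammer 1 n) * (3/128) ^ n) sums
      ((8/75) * ((sqrt 2 * Gamma (1/5) ^ 3 * Gamma (2/5)) / ((sqrt 5 + 1) * pi\<^sup>2)))"
    using real_sums by (simp add: mult_ac)
  \<comment> \<open>All parameters are real, so the complex series is the image of the real one
    under \<open>of_real\<close>.\<close>
  from sums_of_real[OF this, where 'a = complex] show ?thesis
    unfolding hyp2F1_def
    by (simp add: sums_iff flip: pochhammer_of_real)
qed

end
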